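(* For a finite alphabet of size $S$, let $\mathcal{D}_0(S)$ be the set of probability distributions on it, and define the minimax redundancy for memoryless sources $$\tilde R_n(\mathcal{D}_0(S))=\inf_{Q}\sup_{P\in\mathcal{D}_0(S)}\frac1n D(P_{X^n}\|Q_{X^n}),$$ where $P_{X^n}=P^{\otimes n}$ is the law of $n$ i.i.d. draws from $P$ and the infimum is over all probability distributions $Q_{X^n}$ on sequences of length $n$. Suppose $S=\alpha n$ with $\alpha\in(0,\frac{e}{2\pi})$ a constant. Then $$\liminf_{n}\tilde R_n(\mathcal{D}_0(S))\ge\frac{\alpha}{2}\lg\Big(\frac{e}{2\pi\alpha}\Big),\qquad \limsup_n\tilde R_n(\mathcal{D}_0(S))\le\lg B_\alpha,$$ where $B_\alpha=\alpha C_\alpha^{\alpha+2}e^{-1/C_\alpha}$ and $C_\alpha=\frac12+\frac12\sqrt{1+\frac4\alpha}$.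
   Context: $\lg=\log_2$. $D(P\|Q)=\sum_x P(x)\lg\frac{P(x)}{Q(x)}$ is the Kullback–Leibler divergence. *)

theory Defs
  imports "HOL-Analysis.Analysis"
begin

definition dists :: "'a set \<Rightarrow> ('a \<Rightarrow> real) set" where
  "dists A = {P. (\<forall>x. P x \<ge> 0) \<and> (\<forall>x. x \<notin> A \<longrightarrow> P x = 0) \<and> (\<Sum>x\<in>A. P x) = 1}"

definition seqs :: "nat \<Rightarrow> nat \<Rightarrow> nat list set" where
  "seqs S n = {xs. length xs = n \<and> set xs \<subseteq> {0..<S}}"

definition iid :: "(nat \<Rightarrow> real) \<Rightarrow> nat list \<Rightarrow> real" where
  "iid P xs = prod_list (map P xs)"

text \<open>KL divergence in bits on a finite set A, with 0 lg(0/q)=0 and p lg(p/0)=+infinity.\<close>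
definition KL :: "'a set \<Rightarrow> ('a \<Rightarrow> real) \<Rightarrow> ('a \<Rightarrow> real) \<Rightarrow> ereal" where
  "KL A P Q = (if \<exists>x\<in>A. P x > 0 \<and> Q x = 0 then \<infinity>
     else ereal (\<Sum>x\<in>{x\<in>A. P x > 0}. P x * log 2 (P x / Q x)))"

definition minimax_red :: "nat \<Rightarrow> nat \<Rightarrow> ereal" where
  "minimax_red n S = (INF Q\<in>dists (seqs S n). SUP P\<in>dists {0..<S}.
      ereal (1 / real n) * KL (seqs S n) (iid P) Q)"

end

theory Submission
  imports Defs "HOL-Probability.Probability" "HOL-Complex_Analysis.Complex_Analysis"
    "HOL-Combinatorics.Multiset_Permutations" "HOL-Real_Asymp.Real_Asymp"
begin

text \<open>Lower bound: let \<open>L\<close> be Laplace's law on sequences, under which all types are equally likely.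
  It is a mixture of i.i.d. laws, so for every \<open>Q\<close> some source \<open>P\<close> satisfies
  \<open>D(P\<^sup>n \<parallel> Q) \<ge> D(P\<^sup>n \<parallel> L)\<close>. The latter divergence is the logarithm of the number of types
  minus the entropy of the multinomial distribution, which is at most that of \<open>S\<close> Gaussians with
  total variance \<open>n + S/12\<close>.

  Upper bound: the redundancy is at most the logarithm of the Shtarkov sum, the total mass of the
  maximum likelihood. Its generating function in \<open>n\<close> is the \<open>S\<close>-th power of
  \<open>\<Sum>\<^sub>j j\<^sup>j z\<^sup>j / j!\<close>, which equals \<open>1 / (1 - t)\<close> at \<open>z = t exp (-t)\<close>; the saddle point is
  \<open>t = 1 - 1/C\<close>.\<close>

section \<open>Sequences and their types\<close>

lemma finite_seqs [simp]: "finite (seqs S n)"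
  unfolding seqs_def using finite_lists_length_eq[of "{0..<S}" n]
  by (simp add: conj_commute)

lemma seqs_0 [simp]: "seqs S 0 = {[]}"
  by (auto simp: seqs_def)

lemma sum_seqs_Suc:
  fixes f :: "nat list \<Rightarrow> 'b::comm_monoid_add"
  shows "sum f (seqs S (Suc n)) = (\<Sum>a<S. \<Sum>xs\<in>seqs S n. f (a # xs))"
proof -
  have "seqs S (Suc n) = (\<lambda>(a, xs). a # xs) ` ({..<S} \<times> seqs S n)"
    by (auto simp: seqs_def length_Suc_conv image_iff)
  then have "sum f (seqs S (Suc n)) = (\<Sum>(a, xs)\<in>{..<S} \<times> seqs S n. f (a # xs))"
    by (simp add: sum.reindex inj_on_def case_prod_beta)
  also have "\<dots> = (\<Sum>a<S. \<Sum>xs\<in>seqs S n. f (a # xs))"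
    by (simp add: sum.cartesian_product)
  finally show ?thesis .
qed

lemma iid_Cons: "iid P (a # xs) = P a * iid P xs"
  by (simp add: iid_def)

lemma sum_iid: "(\<Sum>xs\<in>seqs S n. iid z xs) = (\<Sum>i<S. z i) ^ n"
proof (induction n)
  case 0
  then show ?case by (simp add: iid_def)
next
  case (Suc n)
  then show ?case
    by (simp add: sum_seqs_Suc iid_Cons flip: sum_distrib_left sum_distrib_right)
qed

lemma iid_eq_prod:
  assumes "xs \<in> seqs S n"
  shows "iid P xs = (\<Prod>i<S. P i ^ count (mset xs) i)"
proof -
  have "iid P xs = prod_mset (image_mset P (mset xs))"
    by (simp add: iid_def prod_mset_prod_list flip: mset_map)
  also have "\<dots> = (\<Prod>i\<in>set xs. P i ^ count (mset xs) i)"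
    by (simp add: image_prod_mset_multiplicity)
  also have "\<dots> = (\<Prod>i<S. P i ^ count (mset xs) i)"
  proof (intro prod.mono_neutral_left ballI)
    show "set xs \<subseteq> {..<S}" using assms by (auto simp: seqs_def)
    fix i assume "i \<in> {..<S} - set xs"
    then have "count (mset xs) i = 0" by simp
    then show "P i ^ count (mset xs) i = 1" by (simp only: power_0)
  qed simp
  finally show ?thesis .
qed

lemma sum_count_seqs:
  assumes "xs \<in> seqs S n"
  shows "(\<Sum>i<S. count (mset xs) i) = n"
proof -
  have "(\<Sum>i<S. count (mset xs) i) = (\<Sum>i\<in>set xs. count (mset xs) i)"
    using assms by (intro sum.mono_neutral_right) (auto simp: seqs_def not_in_iff)
  also have "\<dots> = n"
    using assms by (simp add: seqs_def flip: size_multiset_overloaded_eq[of "mset xs", simplified])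
  finally show ?thesis .
qed

lemma count_le_seqs: "xs \<in> seqs S n \<Longrightarrow> count (mset xs) i \<le> n"
  using count_le_length[of xs i] by (simp add: seqs_def count_mset)

text \<open>Up to the factor n! this is the reciprocal of the size of the type class of the
  sequence, so all types receive the same total weight. Normalized, it is Laplace's add-one
  law.\<close>

definition fact_weight :: "nat \<Rightarrow> nat list \<Rightarrow> real" where
  "fact_weight S xs = (\<Prod>i<S. fact (count (mset xs) i))"

lemma fact_weight_pos: "fact_weight S xs > 0"
  by (simp add: fact_weight_def prod_pos)

text \<open>Prepending a symbol multiplies the weight by its current count plus one. Summed over the
  symbol this factor is n + S, the denominator of Laplace's rule, whatever the sequence.\<close>

lemma sum_fact_weight: "(\<Sum>xs\<in>seqs S n. fact_weight S xs) = pochhammer (real S) n"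
proof (induction n)
  case 0
  then show ?case by (simp add: fact_weight_def)
next
  case (Suc n)
  have step: "fact_weight S (a # xs) = fact_weight S xs * (count (mset xs) a + 1)" if "a < S" for a xs
  proof -
    have "fact_weight S (a # xs) = fact (count (mset xs) a + 1) * (\<Prod>i\<in>{..<S}-{a}. fact (count (mset xs) i))"
      using that unfolding fact_weight_def
      by (subst prod.remove[of _ a]) (auto intro!: prod.cong)
    moreover have "fact_weight S xs = fact (count (mset xs) a) * (\<Prod>i\<in>{..<S}-{a}. fact (count (mset xs) i))"
      using that unfolding fact_weight_def
      by (subst prod.remove[of _ a]) auto
    ultimately show ?thesis by (simp add: algebra_simps)
  qed
  have "(\<Sum>xs\<in>seqs S (Suc n). fact_weight S xs)
      = (\<Sum>a<S. \<Sum>xs\<in>seqs S n. fact_weight S xs * (count (mset xs) a + 1))"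
    unfolding sum_seqs_Suc by (intro sum.cong) (auto simp: step)
  also have "\<dots> = (\<Sum>xs\<in>seqs S n. \<Sum>a<S. fact_weight S xs * (count (mset xs) a + 1))"
    by (rule sum.swap)
  also have "\<dots> = (\<Sum>xs\<in>seqs S n. fact_weight S xs * (n + S))"
  proof (intro sum.cong refl)
    fix xs assume "xs \<in> seqs S n"
    then have "(\<Sum>a<S. real (count (mset xs) a)) = n"
      by (simp add: sum_count_seqs flip: of_nat_sum)
    then show "(\<Sum>a<S. fact_weight S xs * (count (mset xs) a + 1)) = fact_weight S xs * (n + S)"
      by (simp add: sum.distrib flip: sum_distrib_left)
  qed
  also have "\<dots> = pochhammer (real S) (Suc n)"
    by (simp add: Suc pochhammer_Suc add_ac flip: sum_distrib_right)
  finally show ?case .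
qed

text \<open>A type class has \<open>n! / \<Prod> t\<^sub>i!\<close> elements, which is cancelled by the weight.\<close>
lemma sum_types_le:
  fixes q :: "nat \<Rightarrow> nat \<Rightarrow> real"
  assumes nn: "\<And>i j. q i j \<ge> 0"
  shows "(\<Sum>xs\<in>seqs S n. fact_weight S xs * (\<Prod>i<S. q i (count (mset xs) i)))
         \<le> fact n * (\<Prod>i<S. \<Sum>j\<le>n. q i j)"
proof -
  define F where "F A = (\<Prod>i<S. q i (count A i))" for A :: "nat multiset"
  define T where "T = mset ` seqs S n"
  have T: "size A = n" "set_mset A \<subseteq> {..<S}" if "A \<in> T" for A
    using that by (auto simp: T_def seqs_def)
  have fibre: "(\<Sum>xs | xs \<in> seqs S n \<and> mset xs = A. fact_weight S xs * (\<Prod>i<S. q i (count (mset xs) i)))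
               = fact n * F A" if "A \<in> T" for A
  proof -
    have "{xs. xs \<in> seqs S n \<and> mset xs = A} = permutations_of_multiset A"
      using T[OF that] by (fastforce simp: seqs_def permutations_of_multiset_def simp flip: size_mset set_mset_mset)
    moreover have "real (card (permutations_of_multiset A)) * (\<Prod>i<S. fact (count A i)) = fact n"
    proof -
      have *: "(\<Prod>i<S. fact (count A i)) = (\<Prod>i\<in>set_mset A. fact (count A i) :: nat)"
        using T[OF that] by (intro prod.mono_neutral_right) (auto simp: not_in_iff)
      have "card (permutations_of_multiset A) * (\<Prod>i<S. fact (count A i)) = fact n"
        unfolding * using card_permutations_of_multiset[of A] T[OF that]
        by (metis dvd_div_mult_self)
      then have "real (card (permutations_of_multiset A) * (\<Prod>i<S. fact (count A i))) = real (fact n)" by metis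
      then show ?thesis by simp
    qed
    ultimately show ?thesis
      by (simp add: permutations_of_multiset_def fact_weight_def F_def mult_ac)
  qed
  have "(\<Sum>xs\<in>seqs S n. fact_weight S xs * (\<Prod>i<S. q i (count (mset xs) i)))
      = (\<Sum>A\<in>T. \<Sum>xs | xs \<in> seqs S n \<and> mset xs = A. fact_weight S xs * (\<Prod>i<S. q i (count (mset xs) i)))"
    unfolding T_def by (rule sum.image_gen) simp
  also have "\<dots> = fact n * (\<Sum>A\<in>T. F A)"
    unfolding sum_distrib_left by (intro sum.cong refl fibre)
  \<comment> \<open>A type is determined by its counts on the alphabet, so the types embed into the
    box of all functions with values at most n. Passing to the whole box drops the constraint that
    the counts add up to n; this is the only loss. \<open>restrict\<close> makes the functions
    extensional, as \<open>PiE\<close> demands.\<close>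
  also have "(\<Sum>A\<in>T. F A) = (\<Sum>f\<in>(\<lambda>A. restrict (count A) {..<S}) ` T. \<Prod>i<S. q i (f i))"
  proof (subst sum.reindex)
    show "inj_on (\<lambda>A. restrict (count A) {..<S}) T"
    proof (intro inj_onI multiset_eqI)
      fix A B i assume AB: "A \<in> T" "B \<in> T" and eq: "restrict (count A) {..<S} = restrict (count B) {..<S}"
      show "count A i = count B i"
      proof (cases "i < S")
        case True
        then show ?thesis using fun_cong[OF eq, of i] by simp
      next
        case False
        then have "i \<notin># A" "i \<notin># B" using T(2) AB by blast+
        then show ?thesis by (simp add: not_in_iff)
      qed
    qed
  qed (simp add: F_def)
  also have "\<dots> \<le> (\<Sum>f\<in>PiE {..<S} (\<lambda>_. {..n}). \<Prod>i<S. q i (f i))"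
    by (intro sum_mono2 finite_PiE)
       (auto simp: T_def PiE_iff extensional_def count_le_seqs nn intro!: prod_nonneg split: if_splits)
  also have "\<dots> = (\<Prod>i<S. \<Sum>j\<le>n. q i j)"
    by (subst prod_sum_PiE) auto
  finally show ?thesis by simp
qed

section \<open>Mixtures of memoryless sources\<close>

text \<open>The standard exponential law is chosen because its k-th moment is k!: the mean of a
  monomial in independent exponential variables is then a product of factorials, as in
  \<open>fact_weight\<close>.\<close>

definition expo :: "real measure" where
  "expo = density lborel (exponential_density 1)"

lemma prob_space_expo: "prob_space expo"
  unfolding expo_def by (rule prob_space_erlang_density) simp

text \<open>The law lives on the nonnegative half-line, so the absolute value changes no moment. It
  makes the integrands nonnegative at every point, so that later inequalities hold pointwise and not
  just almost everywhere.\<close>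

lemma has_bochner_integral_expo: "has_bochner_integral expo (\<lambda>x. \<bar>x\<bar> ^ k) (fact k)"
proof (rule has_bochner_integral_nn_integral)
  have "(\<integral>\<^sup>+ x. ennreal (\<bar>x\<bar> ^ k) \<partial>expo) = (\<integral>\<^sup>+ x. ennreal (erlang_density 0 1 x * x ^ k) \<partial>lborel)"
    unfolding expo_def
    by (subst nn_integral_density) (auto simp: exponential_density_def erlang_density_def ennreal_mult[symmetric] intro!: nn_integral_cong)
  also have "\<dots> = ennreal (fact k)"
    by (subst nn_integral_erlang_ith_moment) auto
  finally show "(\<integral>\<^sup>+ x. ennreal (\<bar>x\<bar> ^ k) \<partial>expo) = ennreal (fact k)" .
qed (auto simp: expo_def)

text \<open>The law with weights \<open>fact_weight\<close> is the mixture of the i.i.d. laws over the uniform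
  distribution on the simplex. Homogenizing the hypothesis to
  \<open>\<Sum>\<^sub>x z\<^sup>x g x \<le> m (\<Sum>\<^sub>i z\<^sub>i)\<^sup>n\<close> and integrating over independent exponential \<open>z\<^sub>i\<close> avoids any
  integral over the simplex.\<close>
lemma sum_fact_weight_le_of_iid:
  fixes g :: "nat list \<Rightarrow> real"
  assumes "S > 0" and bound: "\<And>P. P \<in> dists {0..<S} \<Longrightarrow> (\<Sum>xs\<in>seqs S n. iid P xs * g xs) \<le> m"
  shows "(\<Sum>xs\<in>seqs S n. fact_weight S xs * g xs) \<le> m * (\<Sum>xs\<in>seqs S n. fact_weight S xs)"
proof -
  interpret E: prob_space expo by (rule prob_space_expo)
  interpret product_prob_space "\<lambda>_. expo" "{..<S}" by unfold_locales
  let ?M = "PiM {..<S} (\<lambda>_. expo)"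
  have int: "integrable expo (\<lambda>x. \<bar>x\<bar> ^ k)" and val: "integral\<^sup>L expo (\<lambda>x. \<bar>x\<bar> ^ k) = fact k" for k
    using has_bochner_integral_expo[of k] by (auto simp: has_bochner_integral_iff)
  have pint: "integrable ?M (\<lambda>z. \<Prod>i<S. \<bar>z i\<bar> ^ count (mset xs) i)" for xs
    by (rule product_integrable_prod) (auto intro: int)
  have pval: "(\<integral>z. (\<Prod>i<S. \<bar>z i\<bar> ^ count (mset xs) i) \<partial>?M) = fact_weight S xs" for xs
    by (subst product_integral_prod) (auto simp: int val fact_weight_def)
  have ineq: "(\<Sum>xs\<in>seqs S n. (\<Prod>i<S. \<bar>z i\<bar> ^ count (mset xs) i) * g xs)
         \<le> m * (\<Sum>xs\<in>seqs S n. \<Prod>i<S. \<bar>z i\<bar> ^ count (mset xs) i)" for z :: "nat \<Rightarrow> real"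
  proof -
    define a where "a i = \<bar>z i\<bar>" for i
    define s where "s = (\<Sum>i<S. a i)"
    \<comment> \<open>When all coordinates vanish there is nothing to normalize; a point mass is a
      default that keeps \<open>P\<close> a distribution, and \<open>a i = s * P i\<close> still
      holds.\<close>
    define P where "P i = (if i < S then if s = 0 then (if i = 0 then 1 else 0) else a i / s else 0)" for i
    have s0: "s \<ge> 0" by (simp add: s_def a_def sum_nonneg)
    have P: "P \<in> dists {0..<S}"
    proof -
      have "(\<Sum>i<S. P i) = 1"
      proof (cases "s = 0")
        case True
        then show ?thesis using \<open>S > 0\<close> by (simp add: P_def sum.delta)
      next
        case False
        then show ?thesis by (simp add: P_def flip: sum_divide_distrib s_def)
      qed
      then show ?thesis
        using s0 by (auto simp: dists_def P_def a_def lessThan_atLeast0)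
    qed
    have a: "a i = s * P i" if "i < S" for i
    proof (cases "s = 0")
      case True
      then have "a i = 0" using that by (simp add: s_def a_def sum_nonneg_eq_0_iff)
      with True show ?thesis by simp
    qed (use that in \<open>simp add: P_def\<close>)
    have iid: "(\<Prod>i<S. \<bar>z i\<bar> ^ count (mset xs) i) = s ^ n * iid P xs" if "xs \<in> seqs S n" for xs
    proof -
      have "(\<Prod>i<S. \<bar>z i\<bar> ^ count (mset xs) i) = (\<Prod>i<S. s ^ count (mset xs) i) * (\<Prod>i<S. P i ^ count (mset xs) i)"
        by (simp add: a power_mult_distrib flip: a_def prod.distrib)
      then show ?thesis
        using that by (simp add: iid_eq_prod sum_count_seqs flip: power_sum)
    qed
    have "(\<Sum>xs\<in>seqs S n. (\<Prod>i<S. \<bar>z i\<bar> ^ count (mset xs) i) * g xs)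
        = s ^ n * (\<Sum>xs\<in>seqs S n. iid P xs * g xs)"
      by (simp add: iid sum_distrib_left mult_ac)
    also have "\<dots> \<le> s ^ n * m"
      using bound[OF P] s0 by (intro mult_left_mono) auto
    also have "\<dots> = m * (\<Sum>xs\<in>seqs S n. \<Prod>i<S. \<bar>z i\<bar> ^ count (mset xs) i)"
    proof -
      have "(\<Sum>xs\<in>seqs S n. \<Prod>i<S. \<bar>z i\<bar> ^ count (mset xs) i) = (\<Sum>xs\<in>seqs S n. iid a xs)"
        by (intro sum.cong) (auto simp: iid_eq_prod a_def)
      then show ?thesis by (simp add: sum_iid s_def)
    qed
    finally show ?thesis .
  qed
  have "(\<Sum>xs\<in>seqs S n. fact_weight S xs * g xs)
      = (\<integral>z. (\<Sum>xs\<in>seqs S n. (\<Prod>i<S. \<bar>z i\<bar> ^ count (mset xs) i) * g xs) \<partial>?M)"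
    by (subst Bochner_Integration.integral_sum) (auto simp: pint pval)
  also have "\<dots> \<le> (\<integral>z. m * (\<Sum>xs\<in>seqs S n. \<Prod>i<S. \<bar>z i\<bar> ^ count (mset xs) i) \<partial>?M)"
    by (intro integral_mono ineq Bochner_Integration.integrable_sum integrable_mult_left
        integrable_mult_right pint)
  also have "\<dots> = m * (\<Sum>xs\<in>seqs S n. fact_weight S xs)"
    by (simp add: pint pval Bochner_Integration.integral_sum)
  finally show ?thesis .
qed

section \<open>The Abel series\<close>

text \<open>Divided by j!, the left side is the j-th term of the exponential series at j.\<close>

lemma power_self_le_fact_exp: "real j ^ j \<le> fact j * exp (real j)"
proof -
  have "(\<Sum>i\<in>{j}. real j ^ i /\<^sub>R fact i) \<le> exp (real j)"
    unfolding exp_def by (rule sum_le_suminf[OF summable_exp_generic]) auto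
  then have "real j ^ j / fact j \<le> exp (real j)"
    by (simp add: divide_inverse_commute)
  then show ?thesis by (simp add: pos_divide_le_eq mult.commute)
qed

text \<open>This is 1 / (1 - T), where T is the tree function, T = z exp T. Complex coefficients
  give access to the identity theorem for holomorphic functions.\<close>

definition abel_series :: "complex fps" where
  "abel_series = Abs_fps (\<lambda>j. of_nat j ^ j / fact j)"

lemma fps_conv_radius_abel_series: "fps_conv_radius abel_series \<ge> exp (-1)"
  unfolding fps_conv_radius_def
proof (rule conv_radius_geI_ex)
  fix r :: real assume r: "0 < r" "ereal r < ereal (exp (-1))"
  show "\<exists>z. norm z = r \<and> summable (\<lambda>j. fps_nth abel_series j * z ^ j)"
  proof (intro exI conjI)
    show "norm (complex_of_real r) = r" using r by simp
    have "r * exp 1 < 1"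
      using r by (simp add: exp_minus inverse_eq_divide pos_less_divide_eq)
    then have "summable (\<lambda>j. (r * exp 1) ^ j)"
      using r by (intro summable_geometric) auto
    moreover have "norm (fps_nth abel_series j * complex_of_real r ^ j) \<le> (r * exp 1) ^ j" for j
    proof -
      have "norm (fps_nth abel_series j * complex_of_real r ^ j) = real j ^ j / fact j * r ^ j"
        using r by (simp add: abel_series_def norm_mult norm_divide norm_power)
      also have "\<dots> \<le> exp (real j) * r ^ j"
        using r power_self_le_fact_exp[of j]
        by (intro mult_right_mono) (auto simp: pos_divide_le_eq mult.commute)
      also have "\<dots> = (r * exp 1) ^ j"
        using exp_of_nat_mult[of j "1::real"] by (simp add: power_mult_distrib mult.commute)
      finally show ?thesis .
    qed
    ultimately show "summable (\<lambda>j. fps_nth abel_series j * complex_of_real r ^ j)"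
      by (rule summable_comparison_test'[where N = 0])
  qed
qed

text \<open>The left side is the m-th finite difference of the m-th power at 0. It is read off as m!
  times the coefficient of X^m in (exp X - 1)^m, computed once by factoring out X^m and once by the
  binomial theorem.\<close>

lemma finite_difference_power:
  "(\<Sum>j\<le>m. of_nat (m choose j) * (-1) ^ (m - j) * of_nat j ^ m) = (fact m :: complex)"
proof -
  have "fps_nth ((fps_exp 1 - 1) ^ m) m = (1 :: complex)"
  proof -
    \<comment> \<open>This is (exp X - 1) / X, with constant coefficient 1.\<close>
    define U :: "complex fps" where "U = fps_shift 1 (fps_exp 1 - 1)"
    have "fps_exp 1 - 1 = fps_X * U"
      by (rule fps_ext) (simp add: U_def)
    then have "(fps_exp 1 - 1) ^ m = fps_X ^ m * U ^ m"
      by (simp add: power_mult_distrib)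
    then show ?thesis
      by (simp add: fps_X_power_mult_nth fps_nth_power_0 U_def)
  qed
  also have "(fps_exp 1 - 1) ^ m = (\<Sum>j\<le>m. of_nat (m choose j) * fps_exp (of_nat j) * (-1) ^ (m - j) :: complex fps)"
    using binomial_ring[of "fps_exp (1::complex)" "-1" m] by (simp add: fps_exp_power_mult)
  also have "fps_nth \<dots> m = (\<Sum>j\<le>m. of_nat (m choose j) * (-1) ^ (m - j) * of_nat j ^ m) / fact m"
  proof -
    have "of_nat (m choose j) * fps_exp (of_nat j) * (-1) ^ (m - j)
        = fps_const (of_nat (m choose j) * (-1) ^ (m - j)) * fps_exp (of_nat j :: complex)" for j
      by (simp add: fps_of_nat mult_ac flip: fps_const_mult fps_const_power fps_const_neg)
    then show ?thesis
      unfolding fps_sum_nth sum_divide_distrib by (intro sum.cong refl) (simp only:, simp)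
  qed
  finally show ?thesis by (simp add: field_simps)
qed

text \<open>The j-th power of X exp (-X) is X^j exp (-jX). Collecting the coefficients of X^m gives
  1 / m! times the finite difference above, hence 1 for every m.\<close>

lemma abel_series_compose:
  "fps_compose abel_series (fps_X * fps_exp (-1)) = inverse (1 - fps_X)"
proof (rule fps_ext)
  fix m
  have nth: "fps_nth ((fps_X * fps_exp (-1)) ^ j) m = (- of_nat j) ^ (m - j) / (fact (m - j) :: complex)"
    if "j \<le> m" for j
    using that by (simp add: power_mult_distrib fps_X_power_mult_nth fps_exp_power_mult not_less)
  have "fps_nth (fps_compose abel_series (fps_X * fps_exp (-1))) m
      = (\<Sum>j\<le>m. of_nat j ^ j / fact j * ((- of_nat j) ^ (m - j) / fact (m - j)))"
    by (simp add: fps_compose_nth abel_series_def nth atLeast0AtMost)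
  also have "\<dots> = (\<Sum>j\<le>m. of_nat (m choose j) * (-1) ^ (m - j) * of_nat j ^ m) / fact m"
    unfolding sum_divide_distrib
  proof (intro sum.cong refl)
    fix j assume "j \<in> {..m}"
    then have pow: "of_nat j ^ m = (of_nat j ^ j * of_nat j ^ (m - j) :: complex)"
      by (simp flip: power_add)
    have binom: "of_nat (m choose j) = (fact m / (fact j * fact (m - j)) :: complex)"
      using \<open>j \<in> {..m}\<close> by (simp add: binomial_fact)
    show "of_nat j ^ j / fact j * ((- of_nat j) ^ (m - j) / fact (m - j))
        = (of_nat (m choose j) * (-1) ^ (m - j) * of_nat j ^ m / fact m :: complex)"
      unfolding pow binom power_minus[of "of_nat j :: complex" "m - j"] by simp
  qed
  also have "\<dots> = fps_nth (inverse (1 - fps_X)) m"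
    by (simp add: finite_difference_power fps_inverse_gp' fps_inverse_one_minus_fps_X)
  finally show "fps_nth (fps_compose abel_series (fps_X * fps_exp (-1))) m = fps_nth (inverse (1 - fps_X)) m" .
qed

text \<open>Keeps the real interval from 0 to 1 inside the disc where the Abel series is known to
  converge.\<close>

lemma mult_exp_minus_less: "t * exp (- t) < exp (-1)" if "0 \<le> t" "t < 1" for t :: real
proof -
  have "t < exp (t - 1)"
    using that exp_minus_greater[of "1 - t"] by (simp add: algebra_simps)
  then have "t * exp (-t) < exp (t - 1) * exp (-t)" by (intro mult_strict_right_mono) auto
  then show ?thesis by (simp add: mult_exp_exp)
qed

text \<open>Both sides are holomorphic on the component of \<open>0\<close> of the set where the series is known
  to converge; they agree near \<open>0\<close> by formal composition.\<close>
lemma abel_series_sums: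
  fixes t :: real
  assumes "0 \<le> t" "t < 1"
  shows "(\<lambda>j. real j ^ j / fact j * (t * exp (-t)) ^ j) sums (1 / (1 - t))"
proof -
  define f where "f w = eval_fps abel_series (w * exp (- w)) - inverse (1 - w)" for w :: complex
  \<comment> \<open>This set also contains real numbers greater than 1, where the identity fails
    because t exp (-t) is not injective. Hence the restriction to the component of 0. The pole 1
    lies just outside, since the inequality is strict.\<close>
  define D where "D = {w :: complex. norm (w * exp (- w)) < exp (-1)}"
  define A where "A = connected_component_set D 0"
  have "open D" unfolding D_def
    by (intro open_Collect_less continuous_intros)
  then have "open A" unfolding A_def by (rule open_connected_component)
  have seg: "complex_of_real s \<in> D" if "0 \<le> s" "s < 1" for s
    using mult_exp_minus_less[of s] that by (simp add: D_def norm_mult norm_exp_eq_Re)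
  have "0 \<in> A" using seg[of 0] by (simp add: A_def)
  moreover have "complex_of_real t \<in> A"
    unfolding A_def
  proof (rule connected_component_maximal[THEN subsetD, of _ "complex_of_real ` {0..t}"])
    show "connected (complex_of_real ` {0..t})"
      by (intro connected_continuous_image continuous_intros) auto
  qed (use assms seg in auto)
  moreover have "1 \<notin> D" by (simp add: D_def norm_exp_eq_Re)
  ultimately have "f (complex_of_real t) = 0"
  proof (intro has_fps_expansion_0_analytic_continuation[where f = f and A = A])
    have AD: "A \<subseteq> D" unfolding A_def by (rule connected_component_subset)
    have "(\<lambda>w. w * exp (- w)) ` A \<subseteq> eball 0 (fps_conv_radius abel_series)"
    proof safe
      fix w assume "w \<in> A"
      then have "ereal (norm (w * exp (- w))) < exp (-1)" using AD by (auto simp: D_def)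
      also note fps_conv_radius_abel_series
      finally show "w * exp (- w) \<in> eball 0 (fps_conv_radius abel_series)" by (simp add: in_eball_iff)
    qed
    then have "(eval_fps abel_series \<circ> (\<lambda>w. w * exp (- w))) holomorphic_on A"
      by (intro holomorphic_on_compose holomorphic_on_eval_fps holomorphic_intros)
    moreover have "1 - w \<noteq> 0" if "w \<in> A" for w using that AD \<open>1 \<notin> D\<close> by auto
    ultimately show "f holomorphic_on A"
      unfolding f_def o_def by (intro holomorphic_intros) auto
    have "(0::ereal) < exp (-1)" by simp
    then have pos: "fps_conv_radius abel_series > 0" using fps_conv_radius_abel_series by (rule less_le_trans)
    have "(eval_fps abel_series \<circ> (\<lambda>w. w * exp (- 1 * w))) has_fps_expansion (fps_compose abel_series (fps_X * fps_exp (-1)))"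
      by (intro fps_expansion_intros eval_fps_has_fps_expansion pos) auto
    then have "f has_fps_expansion (fps_compose abel_series (fps_X * fps_exp (-1)) - inverse (1 - fps_X))"
      unfolding f_def o_def by (auto intro!: fps_expansion_intros)
    then show "f has_fps_expansion 0" by (simp add: abel_series_compose)
    show "connected A" by (simp add: A_def)
  qed (rule \<open>open A\<close>)
  then have val: "eval_fps abel_series (complex_of_real (t * exp (- t))) = complex_of_real (1 / (1 - t))"
    by (simp add: f_def exp_of_real inverse_eq_divide flip: of_real_minus)
  have "ereal (norm (complex_of_real (t * exp (-t)))) < exp (-1)"
    using mult_exp_minus_less[OF assms] assms by (simp add: norm_mult)
  also note fps_conv_radius_abel_series
  finally have "(\<lambda>j. fps_nth abel_series j * complex_of_real (t * exp (-t)) ^ j) sums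
      eval_fps abel_series (complex_of_real (t * exp (- t)))"
    by (rule sums_eval_fps)
  then have "(\<lambda>j. complex_of_real (real j ^ j / fact j * (t * exp (-t)) ^ j)) sums complex_of_real (1 / (1 - t))"
    unfolding val by (simp add: abel_series_def)
  then show ?thesis by (simp only: sums_of_real_iff)
qed

section \<open>Entropy bounds\<close>

text \<open>Each term is bounded below by \<open>p x - r x\<close>, using ln y <= y - 1 at y = r/p.
  The weights \<open>r\<close> may have total mass below 1, so a reference law need not be
  normalized.\<close>

lemma gibbs_ineq:
  fixes p r :: "'a \<Rightarrow> real"
  assumes "finite A" and p: "\<And>x. x \<in> A \<Longrightarrow> p x \<ge> 0" and r: "\<And>x. x \<in> A \<Longrightarrow> r x > 0"
    and "(\<Sum>x\<in>A. p x) = 1" and "(\<Sum>x\<in>A. r x) \<le> 1"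
  shows "(\<Sum>x\<in>A. p x * ln (p x / r x)) \<ge> 0"
proof -
  have "p x * ln (p x / r x) \<ge> p x - r x" if "x \<in> A" for x
  proof (cases "p x = 0")
    case True
    then show ?thesis using r[OF that] by simp
  next
    case False
    then have pos: "p x > 0" "r x > 0" using p[OF that] r[OF that] by auto
    then have "ln (r x / p x) \<le> r x / p x - 1" by (intro ln_le_minus_one) simp
    then have "p x * ln (r x / p x) \<le> r x - p x"
      using mult_left_mono[of _ _ "p x"] pos by (fastforce simp: field_simps)
    then show ?thesis using pos by (simp add: ln_div algebra_simps)
  qed
  then have "(\<Sum>x\<in>A. p x - r x) \<le> (\<Sum>x\<in>A. p x * ln (p x / r x))" by (intro sum_mono)
  then show ?thesis using assms by (simp add: sum_subtractf)
qed

section \<open>Distributions, i.i.d. laws and their divergence as a real sum\<close>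

lemma dists_nonneg: "P \<in> dists A \<Longrightarrow> P x \<ge> 0"
  and dists_sum: "P \<in> dists A \<Longrightarrow> sum P A = 1"
  by (auto simp: dists_def)

lemma iid_nonneg: "P \<in> dists {0..<S} \<Longrightarrow> iid P xs \<ge> 0"
  by (induction xs) (auto simp: iid_def dists_nonneg)

lemma sum_iid_dists: "P \<in> dists {0..<S} \<Longrightarrow> (\<Sum>xs\<in>seqs S n. iid P xs) = 1"
  by (simp add: sum_iid dists_sum lessThan_atLeast0)

lemma KL_iid_eq:
  assumes P: "P \<in> dists {0..<S}" and Q: "\<And>xs. xs \<in> seqs S n \<Longrightarrow> Q xs > 0"
  shows "KL (seqs S n) (iid P) Q = ereal ((\<Sum>xs\<in>seqs S n. iid P xs * ln (iid P xs / Q xs)) / ln 2)"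
proof -
  have "(\<Sum>xs | xs \<in> seqs S n \<and> iid P xs > 0. iid P xs * log 2 (iid P xs / Q xs))
      = (\<Sum>xs\<in>seqs S n. iid P xs * log 2 (iid P xs / Q xs))"
    using iid_nonneg[OF P] by (intro sum.mono_neutral_left) (auto simp: not_less antisym)
  moreover have "\<not> (\<exists>x\<in>seqs S n. iid P x > 0 \<and> Q x = 0)"
    using Q by fastforce
  ultimately show ?thesis
    by (simp add: KL_def log_def sum_divide_distrib)
qed

section \<open>Mean and variance of the count of one symbol under an i.i.d. source\<close>

context
  fixes S :: nat and P :: "nat \<Rightarrow> real"
  assumes P: "P \<in> dists {0..<S}"
begin

text \<open>Induction on the length, splitting off the first symbol: it raises the count with
  probability \<open>P i\<close>, independently of the rest.\<close>

lemma sum_iid_count: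
  assumes i: "i < S"
  shows "(\<Sum>xs\<in>seqs S n. iid P xs * count (mset xs) i) = n * P i"
proof (induction n)
  case 0
  then show ?case by simp
next
  case (Suc n)
  have P1: "(\<Sum>a<S. P a) = 1" using dists_sum[OF P] by (simp add: lessThan_atLeast0)
  have "(\<Sum>xs\<in>seqs S (Suc n). iid P xs * count (mset xs) i)
      = (\<Sum>a<S. P a * (\<Sum>xs\<in>seqs S n. iid P xs * count (mset xs) i)
           + (if a = i then P a * (\<Sum>xs\<in>seqs S n. iid P xs) else 0))"
    unfolding sum_seqs_Suc
    by (intro sum.cong refl) (auto simp: iid_Cons algebra_simps sum.distrib sum_distrib_left)
  also have "\<dots> = n * P i + P i"
    using i by (simp add: sum.distrib Suc sum_iid_dists[OF P] P1 flip: sum_distrib_right)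
  finally show ?case by (simp add: algebra_simps)
qed

lemma sum_iid_count_sq:
  assumes i: "i < S"
  shows "(\<Sum>xs\<in>seqs S n. iid P xs * (real (count (mset xs) i))\<^sup>2) = n * P i + real n * (real n - 1) * (P i)\<^sup>2"
proof (induction n)
  case 0
  then show ?case by simp
next
  case (Suc n)
  have P1: "(\<Sum>a<S. P a) = 1" using dists_sum[OF P] by (simp add: lessThan_atLeast0)
  have "(\<Sum>xs\<in>seqs S (Suc n). iid P xs * (real (count (mset xs) i))\<^sup>2)
      = (\<Sum>a<S. P a * (\<Sum>xs\<in>seqs S n. iid P xs * (real (count (mset xs) i))\<^sup>2)
           + (if a = i then P a * (\<Sum>xs\<in>seqs S n. iid P xs)
                + 2 * P a * (\<Sum>xs\<in>seqs S n. iid P xs * count (mset xs) i) else 0))"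
    unfolding sum_seqs_Suc
    by (intro sum.cong refl) (auto simp: iid_Cons algebra_simps power2_eq_square sum.distrib sum_distrib_left)
  also have "\<dots> = n * P i + real n * (real n - 1) * (P i)\<^sup>2 + (P i + 2 * P i * (n * P i))"
    using i by (simp add: sum.distrib Suc sum_iid_dists[OF P] sum_iid_count P1 flip: sum_distrib_right)
  finally show ?case by (simp add: algebra_simps power2_eq_square)
qed

text \<open>The exact variance is n P_i (1 - P_i). The cruder bound is kept because it sums over the
  alphabet to n, independently of \<open>P\<close>.\<close>

lemma sum_iid_count_variance:
  assumes i: "i < S"
  shows "(\<Sum>xs\<in>seqs S n. iid P xs * (real (count (mset xs) i) - n * P i)\<^sup>2) \<le> n * P i"
proof -
  have "(\<Sum>xs\<in>seqs S n. iid P xs * (real (count (mset xs) i) - n * P i)\<^sup>2)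
      = (\<Sum>xs\<in>seqs S n. iid P xs * (real (count (mset xs) i))\<^sup>2)
        - 2 * n * P i * (\<Sum>xs\<in>seqs S n. iid P xs * count (mset xs) i) 
        + (n * P i)\<^sup>2 * (\<Sum>xs\<in>seqs S n. iid P xs)"
    unfolding power2_diff[of "real _"] sum_distrib_left
    by (simp add: ring_distribs sum.distrib sum_subtractf mult_ac)
  also have "\<dots> = n * P i - n * (P i)\<^sup>2"
    unfolding sum_iid_count[OF i] sum_iid_count_sq[OF i] sum_iid_dists[OF P]
    by (simp add: power2_eq_square algebra_simps)
  also have "\<dots> \<le> n * P i" by simp
  finally show ?thesis .
qed

end

text \<open>Integrating the tangent line of \<open>exp\<close> over a unit interval, which is where \<open>1/12\<close>, the
  variance of the uniform distribution, comes from.\<close>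
lemma sum_lattice_gaussian_le:
  fixes m \<sigma> :: real
  assumes "\<sigma> > 0"
  shows "(\<Sum>j\<le>n. exp (- (((real j - m)\<^sup>2 + 1/12) / (2 * \<sigma>\<^sup>2)))) \<le> sqrt (2 * pi * \<sigma>\<^sup>2)"
proof -
  \<comment> \<open>Half-open unit intervals around the integers are disjoint, so the masses that
    the normal density gives them add up to at most 1.\<close>
  define I where "I j = {real j - 1/2 ..< real j + 1/2}" for j
  define \<phi> where "\<phi> = normal_density m \<sigma>"
  have int: "integrable lborel \<phi>" unfolding \<phi>_def using assms by (intro integrable_normal_density)
  have nn: "\<phi> x \<ge> 0" for x unfolding \<phi>_def by simp
  have piece: "exp (- (((real j - m)\<^sup>2 + 1/12) / (2 * \<sigma>\<^sup>2))) / sqrt (2 * pi * \<sigma>\<^sup>2)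
       \<le> (LINT x:I j|lborel. \<phi> x)" for j
  proof -
    define c where "c = ((real j - m)\<^sup>2 + 1/12) / (2 * \<sigma>\<^sup>2)"
    define K where "K = sqrt (2 * pi * \<sigma>\<^sup>2)"
    have K: "K > 0" using assms by (simp add: K_def)
    \<comment> \<open>\<open>c\<close> is the average of (x - m)^2 / (2 \<sigma>^2) over the unit
      interval centred at j. The linear term of the tangent at -c therefore integrates to zero,
      leaving \<open>exp (- c) / K\<close>. \<open>G\<close> is an antiderivative of
      \<open>L\<close>.\<close>
    define L where "L x = exp (- c) * (1 + c - (x - m)\<^sup>2 / (2 * \<sigma>\<^sup>2)) / K" for x
    define G where "G x = exp (- c) * ((1 + c) * x - (x - m) ^ 3 / (6 * \<sigma>\<^sup>2)) / K" for x
    have LG: "(G has_real_derivative L x) (at x)" for x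
      unfolding G_def L_def using assms K
      by (auto intro!: derivative_eq_intros simp: field_simps power2_eq_square)
    have "L x \<le> \<phi> x" for x
    proof -
      have "1 + c - (x - m)\<^sup>2 / (2 * \<sigma>\<^sup>2) \<le> exp (c - (x - m)\<^sup>2 / (2 * \<sigma>\<^sup>2))"
        using exp_ge_add_one_self[of "c - (x - m)\<^sup>2 / (2 * \<sigma>\<^sup>2)"] by linarith
      then have "exp (- c) * (1 + c - (x - m)\<^sup>2 / (2 * \<sigma>\<^sup>2)) \<le> exp (- c) * exp (c - (x - m)\<^sup>2 / (2 * \<sigma>\<^sup>2))"
        by (rule mult_left_mono) simp
      also have "\<dots> = exp (- ((x - m)\<^sup>2 / (2 * \<sigma>\<^sup>2)))"
        by (simp add: mult_exp_exp)
      finally show ?thesis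
        using K by (simp add: L_def \<phi>_def normal_density_def flip: K_def) (rule divide_right_mono, auto)
    qed
    have fc: "has_bochner_integral lborel (\<lambda>x. L x * indicator {real j - 1/2 .. real j + 1/2} x) (G (real j + 1/2) - G (real j - 1/2))"
      by (rule has_bochner_integral_FTC_Icc_real) (use LG assms K in \<open>auto simp: L_def intro!: continuous_intros\<close>)
    have diff: "G (real j + 1/2) - G (real j - 1/2) = exp (- c) / K"
    proof -
      have "G (real j + 1/2) - G (real j - 1/2)
          = exp (- c) / K * (1 + c - (3 * (real j - m)\<^sup>2 + 1/4) / (6 * \<sigma>\<^sup>2))"
        using assms K by (simp add: G_def field_simps power2_eq_square power3_eq_cube)
      also have "(3 * (real j - m)\<^sup>2 + 1/4) / (6 * \<sigma>\<^sup>2) = c"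
        using assms by (simp add: c_def field_simps)
      finally show ?thesis by simp
    qed
    have "(LINT x|lborel. L x * indicator {real j - 1/2 .. real j + 1/2} x)
        \<le> (LINT x|lborel. indicator {real j - 1/2 .. real j + 1/2} x *\<^sub>R \<phi> x)"
      using fc by (intro integral_mono integrable_mult_indicator int)
        (auto simp: has_bochner_integral_iff \<open>\<And>x. L x \<le> \<phi> x\<close> split: split_indicator)
    also have "\<dots> = (LINT x:I j|lborel. \<phi> x)"
      unfolding set_lebesgue_integral_def
    proof (rule integral_cong_AE)
      show "AE x in lborel. indicator {real j - 1/2 .. real j + 1/2} x *\<^sub>R \<phi> x = indicator (I j) x *\<^sub>R \<phi> x"
        using AE_lborel_singleton[of "real j + 1/2"]
        by eventually_elim (auto simp: I_def split: split_indicator)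
    qed (auto simp: I_def \<phi>_def)
    finally show ?thesis
      using fc diff by (simp add: has_bochner_integral_iff c_def K_def)
  qed
  have "(\<Sum>j\<le>n. exp (- (((real j - m)\<^sup>2 + 1/12) / (2 * \<sigma>\<^sup>2)))) / sqrt (2 * pi * \<sigma>\<^sup>2)
      \<le> (\<Sum>j\<le>n. LINT x:I j|lborel. \<phi> x)"
    unfolding sum_divide_distrib by (intro sum_mono piece)
  also have "\<dots> = (LINT x:(\<Union>j\<le>n. I j)|lborel. \<phi> x)"
  proof (rule set_integral_finite_Union[symmetric])
    show "disjoint_family_on I {..n}"
    proof (unfold disjoint_family_on_def, intro ballI impI)
      fix i j :: nat assume "i \<noteq> j"
      then have "i + 1 \<le> j \<or> j + 1 \<le> i" by linarith
      then have "real i + 1 \<le> real j \<or> real j + 1 \<le> real i"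
        by (metis of_nat_1 of_nat_add of_nat_le_iff)
      then show "I i \<inter> I j = {}" by (auto simp: I_def)
    qed
    show "set_integrable lborel (I j) \<phi>" for j
      unfolding set_integrable_def using int by (intro integrable_mult_indicator) (auto simp: I_def)
  qed (auto simp: I_def)
  also have "\<dots> \<le> (LINT x|lborel. \<phi> x)"
    unfolding set_lebesgue_integral_def
    by (intro integral_mono integrable_mult_indicator int) (auto simp: I_def nn split: split_indicator)
  also have "\<dots> = 1" unfolding \<phi>_def using assms by (intro integral_normal_density)
  finally show ?thesis
    using assms by (simp add: divide_le_eq)
qed

section \<open>Redundancy for fixed length\<close>

text \<open>Gibbs' inequality against a product of lattice Gaussians centred at the means \<open>n P\<^sub>i\<close> of the
  counts. Giving all of them the same variance \<open>v\<close> makes the bound uniform in \<open>P\<close>, because the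
  variances of the counts add up to at most \<open>n\<close>.\<close>
lemma divergence_from_laplace_lower:
  fixes S n :: nat
  assumes P: "P \<in> dists {0..<S}" and "S > 0"
  defines "v \<equiv> real n / real S + 1/12"
  shows "(\<Sum>xs\<in>seqs S n. iid P xs * ln (iid P xs / (fact_weight S xs / pochhammer (real S) n)))
       \<ge> ln (pochhammer (real S) n / fact n) - real S / 2 * (ln (2 * pi * v) + 1)"
proof -
  define \<sigma> where "\<sigma> = sqrt v"
  have v: "v > 0" using \<open>S > 0\<close> by (simp add: v_def add_nonneg_pos)
  then have \<sigma>: "\<sigma> > 0" "\<sigma>\<^sup>2 = v" by (auto simp: \<sigma>_def)
  define Z where "Z = pochhammer (real S) n"
  have Z: "Z > 0" using \<open>S > 0\<close> by (simp add: Z_def pochhammer_pos)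
  define q where "q i j = exp (- (((real j - real n * P i)\<^sup>2 + 1/12) / (2 * v))) / sqrt (2 * pi * v)" for i j :: nat
  have q: "q i j > 0" for i j using v by (simp add: q_def)
  have q0: "q i j \<noteq> 0" for i j using v by (simp add: q_def)
  have q1: "(\<Sum>j\<le>n. q i j) \<le> 1" for i
    using sum_lattice_gaussian_le[OF \<sigma>(1), where m = "real n * P i" and n = n] v
    by (simp add: q_def \<sigma> divide_le_eq flip: sum_divide_distrib)
  \<comment> \<open>The product of the \<open>q\<close> is a weight on types; \<open>R\<close>
    spreads it evenly over each type class. Its total mass is at most 1 because each lattice
    Gaussian has mass at most 1.\<close>
  define R where "R xs = fact_weight S xs * (\<Prod>i<S. q i (count (mset xs) i)) / fact n" for xs
  have R: "R xs > 0" for xs by (simp add: R_def fact_weight_pos q prod_pos)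
  have "(\<Sum>xs\<in>seqs S n. R xs) \<le> fact n * (\<Prod>i<S. \<Sum>j\<le>n. q i j) / fact n"
    unfolding R_def sum_divide_distrib[symmetric]
    by (intro divide_right_mono sum_types_le) (auto intro: less_imp_le q)
  also have "\<dots> \<le> 1"
    using q q1 by (simp add: prod_le_1 sum_nonneg less_imp_le)
  finally have R1: "(\<Sum>xs\<in>seqs S n. R xs) \<le> 1" .
  have gibbs: "0 \<le> (\<Sum>xs\<in>seqs S n. iid P xs * ln (iid P xs / R xs))"
    by (rule gibbs_ineq) (auto simp: R R1 iid_nonneg[OF P] sum_iid_dists[OF P])
  have lnq: "ln (q i j) = - (((real j - real n * P i)\<^sup>2 + 1/12) / (2 * v)) - ln (2 * pi * v) / 2" for i j
    unfolding q_def using v by (subst ln_div) (auto simp: ln_sqrt)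
  \<comment> \<open>The ratio of \<open>R\<close> to Laplace's law is \<open>Z / fact n\<close>, the
    number of types, times the product of the \<open>q\<close>. The first summand is left to Gibbs'
    inequality.\<close>
  have split: "iid P xs * ln (iid P xs / (fact_weight S xs / Z)) = iid P xs * ln (iid P xs / R xs)
      + (iid P xs * ln (Z / fact n) + (\<Sum>i<S. iid P xs * ln (q i (count (mset xs) i))))" for xs
  proof (cases "iid P xs = 0")
    case False
    then have pos: "iid P xs > 0" using iid_nonneg[OF P, of xs] by simp
    have "iid P xs / (fact_weight S xs / Z) = (iid P xs / R xs) * ((Z / fact n) * (\<Prod>i<S. q i (count (mset xs) i)))"
      using less_imp_neq[OF fact_weight_pos[of S xs]]
      by (simp add: R_def q0 eq_commute[of 0])
    also have "ln \<dots> = ln (iid P xs / R xs) + (ln (Z / fact n) + ln (\<Prod>i<S. q i (count (mset xs) i)))"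
      using pos R[of xs] Z q
      by (subst ln_mult_pos) (auto simp: prod_pos ln_mult_pos q0 simp del: times_divide_eq_left)
    also have "ln (\<Prod>i<S. q i (count (mset xs) i)) = (\<Sum>i<S. ln (q i (count (mset xs) i)))"
      by (intro ln_prod) (auto simp: q0)
    finally show ?thesis by (simp add: ring_distribs sum_distrib_left)
  qed simp
  have coord: "(\<Sum>xs\<in>seqs S n. iid P xs * ln (q i (count (mset xs) i)))
      \<ge> - (real n * P i + 1/12) / (2 * v) - ln (2 * pi * v) / 2" if "i < S" for i
  proof -
    have "(\<Sum>xs\<in>seqs S n. iid P xs * ln (q i (count (mset xs) i)))
        = - ((\<Sum>xs\<in>seqs S n. iid P xs * (real (count (mset xs) i) - real n * P i)\<^sup>2) / (2 * v))
          - (1/12 / (2 * v) + ln (2 * pi * v) / 2) * (\<Sum>xs\<in>seqs S n. iid P xs)"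
      unfolding lnq
      by (simp add: sum_distrib_left sum_divide_distrib flip: sum_negf sum_subtractf)
        (use v in \<open>intro sum.cong refl, simp add: field_simps\<close>)
    also have "\<dots> \<ge> - (real n * P i / (2 * v)) - (1/12 / (2 * v) + ln (2 * pi * v) / 2)"
      using sum_iid_count_variance[OF P that, of n] v
      by (simp add: sum_iid_dists[OF P] divide_right_mono)
    finally show ?thesis by (simp add: diff_divide_distrib)
  qed
  \<comment> \<open>The choice of \<open>v\<close> shows here: the bounds n P_i + 1/12 add up to n +
    S/12 = S v, so the quadratic terms contribute exactly S/2.\<close>
  have "ln (Z / fact n) - real S / 2 * (ln (2 * pi * v) + 1)
      = ln (Z / fact n) + (\<Sum>i<S. - (real n * P i + 1/12) / (2 * v) - ln (2 * pi * v) / 2)"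
  proof -
    have "(\<Sum>i<S. P i) = 1" using dists_sum[OF P] by (simp add: lessThan_atLeast0)
    then have "(\<Sum>i<S. real n * P i + 1/12) = real n + real S / 12"
      by (simp add: sum.distrib flip: sum_distrib_left)
    also have "\<dots> = real S * v" using \<open>S > 0\<close> by (simp add: v_def field_simps)
    finally have "(\<Sum>i<S. real n * P i + 1/12) / (2 * v) = real S / 2" using v by simp
    moreover have "(\<Sum>i<S. - (real n * P i + 1/12) / (2 * v) - ln (2 * pi * v) / 2)
        = - ((\<Sum>i<S. real n * P i + 1/12) / (2 * v)) - real S * (ln (2 * pi * v) / 2)"
      by (simp only: sum_subtractf sum_constant card_lessThan minus_divide_left[symmetric] sum_negf
          sum_divide_distrib)
    ultimately show ?thesis by (simp add: algebra_simps)
  qed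
  also have "\<dots> \<le> ln (Z / fact n) + (\<Sum>i<S. \<Sum>xs\<in>seqs S n. iid P xs * ln (q i (count (mset xs) i)))"
    using coord by (intro add_left_mono sum_mono) auto
  also have "\<dots> = (\<Sum>xs\<in>seqs S n. iid P xs * ln (Z / fact n) + (\<Sum>i<S. iid P xs * ln (q i (count (mset xs) i))))"
    by (subst sum.swap) (simp add: sum.distrib sum_iid_dists[OF P] flip: sum_distrib_right)
  also have "\<dots> \<le> (\<Sum>xs\<in>seqs S n. iid P xs * ln (iid P xs / (fact_weight S xs / Z)))"
    unfolding split using gibbs by (simp add: sum.distrib)
  finally show ?thesis unfolding Z_def .
qed

text \<open>A worst-case rate r of Q bounds the divergence from Q of every source. Subtracting the
  lower bound on the divergence from Laplace's law L leaves a bound, uniform in P, on the mean of ln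
  (L/Q). Averaging over the mixture turns this mean into D(L || Q), which is nonnegative.\<close>

lemma minimax_red_lower:
  assumes "S > 0" "n > 0"
  shows "minimax_red n S \<ge> ereal ((ln (pochhammer (real S) n / fact n)
      - real S / 2 * (ln (2 * pi * (real n / real S + 1/12)) + 1)) / (real n * ln 2))"
    (is "_ \<ge> ereal (?D / _)")
  unfolding minimax_red_def
proof (rule INF_greatest)
  fix Q assume Q: "Q \<in> dists (seqs S n)"
  define D where "D = ?D"
  have Qnn: "Q xs \<ge> 0" for xs using Q by (simp add: dists_def)
  show "ereal (D / (real n * ln 2)) \<le> (SUP P\<in>dists {0..<S}. ereal (1 / real n) * KL (seqs S n) (iid P) Q)"
  proof (cases "\<exists>xs\<in>seqs S n. Q xs = 0")
    case True
    then obtain xs where xs: "xs \<in> seqs S n" "Q xs = 0" by blast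
    \<comment> \<open>The uniform source charges every sequence, so a zero of Q makes its divergence
      infinite.\<close>
    define U where "U i = (if i < S then 1 / real S else 0)" for i
    have U: "U \<in> dists {0..<S}" using \<open>S > 0\<close> by (auto simp: dists_def U_def)
    have "iid U xs > 0"
      using xs \<open>S > 0\<close> by (simp add: iid_eq_prod U_def prod_pos)
    then have "KL (seqs S n) (iid U) Q = \<infinity>" using xs by (auto simp: KL_def)
    then have "ereal (1 / real n) * KL (seqs S n) (iid U) Q = \<infinity>" using \<open>n > 0\<close> by simp
    then have "(SUP P\<in>dists {0..<S}. ereal (1 / real n) * KL (seqs S n) (iid P) Q) = \<infinity>"
      using SUP_upper[OF U, of "\<lambda>P. ereal (1 / real n) * KL (seqs S n) (iid P) Q"] by simp
    then show ?thesis by simp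
  next
    case False
    then have Qpos: "Q xs > 0" if "xs \<in> seqs S n" for xs
      using that Qnn[of xs] by (force simp: less_le)
    show ?thesis
    \<comment> \<open>Comparing with an arbitrary real upper bound of the supremum keeps all
      divergences finite.\<close>
    proof (rule ereal_le_real)
      fix r assume "(SUP P\<in>dists {0..<S}. ereal (1 / real n) * KL (seqs S n) (iid P) Q) \<le> ereal r"
      then have r: "ereal (1 / real n) * KL (seqs S n) (iid P) Q \<le> ereal r" if "P \<in> dists {0..<S}" for P
        using that by (simp add: SUP_le_iff)
      define Z where "Z = pochhammer (real S) n"
      have Z: "Z > 0" using \<open>S > 0\<close> by (simp add: Z_def pochhammer_pos)
      define L where "L xs = fact_weight S xs / Z" for xs
      have L: "L xs > 0" for xs using Z by (simp add: L_def fact_weight_pos)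
      have L1: "(\<Sum>xs\<in>seqs S n. L xs) = 1"
        using Z by (simp add: L_def sum_fact_weight flip: sum_divide_distrib Z_def)
      have "(\<Sum>xs\<in>seqs S n. iid P xs * ln (L xs / Q xs)) \<le> r * (real n * ln 2) - D"
        if P: "P \<in> dists {0..<S}" for P
      proof -
        have "(\<Sum>xs\<in>seqs S n. iid P xs * ln (iid P xs / Q xs)) \<le> r * (real n * ln 2)"
          using r[OF P] KL_iid_eq[OF P Qpos] \<open>n > 0\<close> by (simp add: field_simps)
        moreover have "(\<Sum>xs\<in>seqs S n. iid P xs * ln (iid P xs / L xs)) \<ge> D"
          using divergence_from_laplace_lower[OF P \<open>S > 0\<close>, of n] by (simp add: D_def L_def Z_def)
        moreover have "(\<Sum>xs\<in>seqs S n. iid P xs * ln (iid P xs / Q xs))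
            = (\<Sum>xs\<in>seqs S n. iid P xs * ln (iid P xs / L xs)) + (\<Sum>xs\<in>seqs S n. iid P xs * ln (L xs / Q xs))"
          unfolding sum.distrib[symmetric]
        proof (intro sum.cong refl)
          fix xs assume "xs \<in> seqs S n"
          then show "iid P xs * ln (iid P xs / Q xs) = iid P xs * ln (iid P xs / L xs) + iid P xs * ln (L xs / Q xs)"
            using Qpos[of xs] L[of xs] iid_nonneg[OF P, of xs]
            by (cases "iid P xs = 0") (auto simp: ln_div less_le algebra_simps)
        qed
        ultimately show ?thesis by simp
      qed
      then have "(\<Sum>xs\<in>seqs S n. fact_weight S xs * ln (L xs / Q xs)) \<le> (r * (real n * ln 2) - D) * Z"
        unfolding Z_def sum_fact_weight[symmetric] by (rule sum_fact_weight_le_of_iid[OF \<open>S > 0\<close>])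
      moreover have "(\<Sum>xs\<in>seqs S n. fact_weight S xs * ln (L xs / Q xs)) = Z * (\<Sum>xs\<in>seqs S n. L xs * ln (L xs / Q xs))"
        using Z by (simp add: L_def sum_distrib_left)
      moreover have "0 \<le> (\<Sum>xs\<in>seqs S n. L xs * ln (L xs / Q xs))"
        using Q by (intro gibbs_ineq) (auto simp: Qpos L1 less_imp_le[OF L] dists_def)
      ultimately have "0 \<le> (r * (real n * ln 2) - D) * Z"
        using mult_nonneg_nonneg[OF less_imp_le[OF Z]] by fastforce
      then have "D \<le> r * (real n * ln 2)"
        using Z by (simp add: zero_le_mult_iff)
      then show "ereal (D / (real n * ln 2)) \<le> ereal r"
        using \<open>n > 0\<close> by (simp add: divide_le_eq)
    qed
  qed
qed

text \<open>The right side is n^n times the maximum likelihood, attained at the empirical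
  distribution. Each factor is handled by x <= exp (x - 1) at x = n P_i / c, and the exponents n P_i
  - c add up to zero.\<close>

lemma iid_le_ml:
  assumes P: "P \<in> dists {0..<S}" and xs: "xs \<in> seqs S n"
  shows "real n ^ n * iid P xs \<le> (\<Prod>i<S. real (count (mset xs) i) ^ count (mset xs) i)"
proof -
  let ?c = "\<lambda>i. count (mset xs) i"
  have one: "(n * P i) ^ c \<le> real c ^ c * exp (n * P i - c)" for i c
  proof (cases "c = 0")
    case True
    then show ?thesis using dists_nonneg[OF P, of i] by simp
  next
    case False
    have "n * P i / c \<le> exp (n * P i / c - 1)"
      using exp_ge_add_one_self[of "n * P i / c - 1"] by simp
    then have "(n * P i / c) ^ c \<le> exp (n * P i / c - 1) ^ c"
      using dists_nonneg[OF P, of i] by (intro power_mono) auto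
    also have "\<dots> = exp (n * P i - c)"
      using False by (simp add: right_diff_distrib flip: exp_of_nat_mult)
    finally show ?thesis using False by (simp add: power_divide field_simps)
  qed
  have "real n ^ n * iid P xs = (\<Prod>i<S. (n * P i) ^ ?c i)"
    using xs by (simp add: iid_eq_prod power_mult_distrib prod.distrib sum_count_seqs flip: power_sum)
  also have "\<dots> \<le> (\<Prod>i<S. real (?c i) ^ ?c i * exp (n * P i - ?c i))"
    using dists_nonneg[OF P] by (intro prod_mono conjI one) auto
  also have "\<dots> = (\<Prod>i<S. real (?c i) ^ ?c i) * exp (\<Sum>i<S. n * P i - ?c i)"
    by (simp add: prod.distrib exp_sum)
  also have "(\<Sum>i<S. n * P i - ?c i) = 0"
    using xs dists_sum[OF P, unfolded atLeast0LessThan]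
    by (simp add: sum_subtractf sum_count_seqs flip: sum_distrib_left of_nat_sum)
  finally show ?thesis by simp
qed

text \<open>A saddle-point bound, valid for every t. The power \<open>z ^ n\<close> distributes over
  the counts, which add up to n, and \<open>fact_weight\<close> cancels the factorials of the Abel
  series. Dropping the constraint on the counts leaves the S-th power of a truncated Abel
  series.\<close>

lemma sum_ml_le:
  fixes t :: real
  assumes "0 < t" "t < 1"
  shows "(\<Sum>xs\<in>seqs S n. \<Prod>i<S. real (count (mset xs) i) ^ count (mset xs) i)
       \<le> fact n * (1 / (1 - t)) ^ S / (t * exp (- t)) ^ n"
proof -
  define z where "z = t * exp (- t)"
  have z: "z > 0" using assms by (simp add: z_def)
  define q where "q j = real j ^ j / fact j * z ^ j" for j
  have "z ^ n * (\<Sum>xs\<in>seqs S n. \<Prod>i<S. real (count (mset xs) i) ^ count (mset xs) i)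
      = (\<Sum>xs\<in>seqs S n. fact_weight S xs * (\<Prod>i<S. q (count (mset xs) i)))"
    unfolding sum_distrib_left
  proof (intro sum.cong refl)
    fix xs assume xs: "xs \<in> seqs S n"
    have "fact_weight S xs * (\<Prod>i<S. q (count (mset xs) i))
        = (\<Prod>i<S. real (count (mset xs) i) ^ count (mset xs) i * z ^ count (mset xs) i)"
      unfolding fact_weight_def prod.distrib[symmetric] by (intro prod.cong) (auto simp: q_def)
    then show "z ^ n * (\<Prod>i<S. real (count (mset xs) i) ^ count (mset xs) i)
        = fact_weight S xs * (\<Prod>i<S. q (count (mset xs) i))"
      using xs by (simp add: prod.distrib sum_count_seqs flip: power_sum)
  qed
  also have "\<dots> \<le> fact n * (\<Prod>i<S. \<Sum>j\<le>n. q j)"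
    using z by (intro sum_types_le) (simp add: q_def)
  also have "(\<Sum>j\<le>n. q j) \<le> 1 / (1 - t)"
  proof -
    have "q sums (1 / (1 - t))"
      using abel_series_sums[of t] assms by (simp add: q_def [abs_def] z_def)
    then show ?thesis
      using z by (metis (no_types, lifting) sum_le_suminf sums_iff finite_atMost q_def divide_nonneg_pos
          mult_nonneg_nonneg of_nat_0_le_iff zero_le_power fact_gt_zero less_imp_le)
  qed
  then have "fact n * (\<Prod>i<S. \<Sum>j\<le>n. q j) \<le> fact n * (1 / (1 - t)) ^ S"
    using z by (auto intro!: mult_left_mono power_mono sum_nonneg simp: q_def)
  finally show ?thesis
    using z by (simp add: pos_le_divide_eq mult.commute flip: z_def)
qed

text \<open>The witness is the Shtarkov distribution, proportional to the maximum likelihood.\<close>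
lemma minimax_red_upper:
  fixes t :: real
  assumes "S > 0" "n > 0" "0 < t" "t < 1"
  shows "minimax_red n S \<le> ereal ((ln (fact n / real n ^ n) - real n * ln t + real n * t
      - real S * ln (1 - t)) / (real n * ln 2))"
proof -
  \<comment> \<open>This is n^n times the maximum likelihood. Since \<open>0 ^ 0 = 1\<close>, absent
    symbols contribute 1 and \<open>K\<close> is positive everywhere.\<close>
  define K where "K xs = (\<Prod>i<S. real (count (mset xs) i) ^ count (mset xs) i)" for xs
  have K: "K xs > 0" for xs
    unfolding K_def by (intro prod_pos) auto
  define Z where "Z = (\<Sum>xs\<in>seqs S n. K xs)"
  have "replicate n 0 \<in> seqs S n" using \<open>S > 0\<close> by (auto simp: seqs_def)
  then have Z: "Z > 0" unfolding Z_def by (intro sum_pos) (auto simp: K)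
  define Q where "Q xs = (if xs \<in> seqs S n then K xs / Z else 0)" for xs
  have "(\<Sum>xs\<in>seqs S n. Q xs) = 1"
    using Z by (simp add: Q_def flip: sum_divide_distrib Z_def)
  then have Q: "Q \<in> dists (seqs S n)"
    using Z by (auto simp: dists_def Q_def less_imp_le[OF K])
  have Qpos: "Q xs > 0" if "xs \<in> seqs S n" for xs using that K Z by (simp add: Q_def)
  have lnZ: "ln (Z / real n ^ n) \<le> ln (fact n / real n ^ n) - real n * ln t + real n * t - real S * ln (1 - t)"
  proof -
    have "Z / real n ^ n \<le> fact n * (1 / (1 - t)) ^ S / (t * exp (- t)) ^ n / real n ^ n"
      using sum_ml_le[OF assms(3,4), of S n] unfolding Z_def K_def by (rule divide_right_mono) simp
    then have "ln (Z / real n ^ n) \<le> ln (fact n * (1 / (1 - t)) ^ S / (t * exp (- t)) ^ n / real n ^ n)"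
      using Z \<open>n > 0\<close> by (intro ln_mono) auto
    also have "\<dots> = ln (fact n / real n ^ n) - real n * ln t + real n * t - real S * ln (1 - t)"
      using assms by (simp add: ln_div ln_mult ln_realpow algebra_simps)
    finally show ?thesis .
  qed
  have "ereal (1 / real n) * KL (seqs S n) (iid P) Q \<le> ereal (ln (Z / real n ^ n) / (real n * ln 2))"
    if P: "P \<in> dists {0..<S}" for P
  proof -
    have "(\<Sum>xs\<in>seqs S n. iid P xs * ln (iid P xs / Q xs)) \<le> (\<Sum>xs\<in>seqs S n. iid P xs * ln (Z / real n ^ n))"
    proof (intro sum_mono)
      fix xs assume xs: "xs \<in> seqs S n"
      show "iid P xs * ln (iid P xs / Q xs) \<le> iid P xs * ln (Z / real n ^ n)"
      proof (cases "iid P xs = 0")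
        case False
        then have pos: "iid P xs > 0" using iid_nonneg[OF P, of xs] by simp
        have "iid P xs / Q xs \<le> Z / real n ^ n"
          using iid_le_ml[OF P xs] xs K[of xs] Z \<open>n > 0\<close>
          by (simp add: Q_def field_simps flip: K_def)
        then show ?thesis
          using pos Qpos[OF xs] by (intro mult_left_mono ln_mono) auto
      qed simp
    qed
    also have "\<dots> = ln (Z / real n ^ n)"
      by (simp add: sum_iid_dists[OF P] flip: sum_distrib_right)
    finally show ?thesis
      using KL_iid_eq[OF P Qpos] \<open>n > 0\<close> by (simp add: divide_right_mono field_simps)
  qed
  then have "(SUP P\<in>dists {0..<S}. ereal (1 / real n) * KL (seqs S n) (iid P) Q)
      \<le> ereal (ln (Z / real n ^ n) / (real n * ln 2))"
    by (intro SUP_least)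
  also have "\<dots> \<le> ereal ((ln (fact n / real n ^ n) - real n * ln t + real n * t
      - real S * ln (1 - t)) / (real n * ln 2))"
    using lnZ by (simp add: divide_right_mono)
  finally show ?thesis
    unfolding minimax_red_def by (rule INF_lower2[OF Q])
qed

section \<open>Asymptotics\<close>

lemma ln_fact_lower:
  assumes "n > 0"
  shows "ln (fact n) \<ge> real n * ln (real n) - real n"
proof -
  have "ln (real n ^ n) \<le> ln (fact n * exp (real n))"
    using power_self_le_fact_exp[of n] assms by (intro ln_mono) auto
  then show ?thesis using assms by (simp add: ln_mult_pos ln_realpow)
qed

text \<open>This is e <= (1 + 1/n)^(n+1) cleared of denominators; it drives the induction in
  \<open>fact_upper\<close>.\<close>

lemma exp_mult_power_le: "exp 1 * real n ^ Suc n \<le> (real n + 1) ^ Suc n"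
proof -
  have "real n / (real n + 1) \<le> exp (- 1 / (real n + 1))"
    using exp_ge_add_one_self[of "- 1 / (real n + 1)"] by (simp add: field_simps)
  then have "(real n / (real n + 1)) ^ Suc n \<le> exp (- 1 / (real n + 1)) ^ Suc n"
    by (intro power_mono) auto
  also have "\<dots> = exp (- 1)"
    using exp_of_nat_mult[of "Suc n" "- 1 / (real n + 1)"] by (simp add: add.commute)
  finally have "real n ^ Suc n / (real n + 1) ^ Suc n \<le> 1 / exp 1"
    by (simp only: power_divide exp_minus inverse_eq_divide)
  moreover have "(real n + 1) ^ Suc n > 0" by (intro zero_less_power) simp
  ultimately have "real n ^ Suc n \<le> 1 / exp 1 * (real n + 1) ^ Suc n"
    by (simp only: pos_divide_le_eq)
  then show ?thesis
    by (simp only: pos_le_divide_eq exp_gt_zero times_divide_eq_left mult_1 mult.commute)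
qed

text \<open>The constant makes n = 1 an equality. The loss against Stirling's formula is of order
  sqrt n, which disappears after taking logarithms and dividing by n.\<close>

lemma fact_upper:
  assumes "n > 0"
  shows "fact n * exp (real n) \<le> exp 1 * real n ^ Suc n"
  using assms
proof (induction n rule: nat_induct_non_zero)
  case (Suc n)
  have "fact (Suc n) * exp (real (Suc n)) = (real n + 1) * exp 1 * (fact n * exp (real n))"
    by (simp add: exp_add algebra_simps)
  also have "\<dots> \<le> (real n + 1) * exp 1 * (exp 1 * real n ^ Suc n)"
    using Suc.IH by (intro mult_left_mono) auto
  also have "\<dots> \<le> (real n + 1) * exp 1 * (real n + 1) ^ Suc n"
    using exp_mult_power_le[of n] by (intro mult_left_mono) auto
  also have "\<dots> = exp 1 * real (Suc n) ^ Suc (Suc n)"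
    by (simp add: add.commute mult_ac)
  finally show ?case .
qed simp

lemma ln_fact_upper:
  assumes "n > 0"
  shows "ln (fact n) \<le> 1 + ln (real n) + real n * ln (real n) - real n"
proof -
  have "ln (fact n * exp (real n)) \<le> ln (exp 1 * real n ^ Suc n)"
    using fact_upper[OF assms] assms by (intro ln_mono) auto
  then show ?thesis
    using assms by (simp add: ln_mult_pos ln_realpow del: power_Suc) (simp add: algebra_simps)
qed

text \<open>The quotient is the binomial coefficient of n + S - 1 over n, the number of types. It is
  written with (n + S)!, n! and S!, which are then estimated by Stirling.\<close>

lemma ln_pochhammer_div_fact_lower:
  assumes "S > 0" "n > 0"
  shows "ln (pochhammer (real S) n / fact n)
    \<ge> (real n + real S) * ln (real n + real S) - real n * ln (real n) - real S * ln (real S)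
       - ln (real n + real S) - ln (real n) - 2"
proof -
  have "fact (S + n) = fact S * pochhammer (1 + real S) n"
    using pochhammer_product'[of "1::real" S n] by (simp add: pochhammer_fact)
  moreover have "pochhammer (real S) n * (real S + real n) = real S * pochhammer (1 + real S) n"
    using pochhammer_Suc[of "real S" n] pochhammer_rec[of "real S" n] by (simp add: add.commute)
  ultimately have "pochhammer (real S) n * (fact S * (real n + real S)) = fact (S + n) * real S"
    by (simp only: ac_simps)
  then have "pochhammer (real S) n = fact (S + n) * real S / (fact S * (real n + real S))"
    using assms by (intro iffD2[OF nonzero_eq_divide_eq]) auto
  then have "ln (pochhammer (real S) n / fact n)
      = ln (fact (S + n)) + ln (real S) - ln (fact S) - ln (real n + real S) - ln (fact n)"
    using assms by (simp add: ln_div ln_mult_pos)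
  then show ?thesis
    using ln_fact_lower[of "S + n"] ln_fact_upper[OF assms(1)] ln_fact_upper[OF assms(2)] assms
    by (simp add: algebra_simps)
qed

text \<open>The right side is the limit of the fixed-length bound. It exceeds the left side by (1 +
  \<alpha>) ln (1 + \<alpha>) - \<alpha> - (\<alpha>/2) ln (1 + \<alpha>/12), so the point is that
  this is nonnegative.\<close>

lemma lower_rate:
  fixes \<alpha> :: real
  assumes "0 < \<alpha>" "\<alpha> < 1 / 2"
  shows "\<alpha> / 2 * ln (exp 1 / (2 * pi * \<alpha>)) \<le> (1 + \<alpha>) * ln (1 + \<alpha>) - \<alpha> * ln \<alpha>
     - \<alpha> / 2 * (ln (2 * pi * (1 / \<alpha> + 1/12)) + 1)"
proof -
  have "ln (1 + \<alpha> / 12) \<le> \<alpha> / 12"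
    using assms by (intro ln_add_one_self_le_self) simp
  then have "\<alpha> / 2 * ln (1 + \<alpha> / 12) \<le> \<alpha> / 2 * (\<alpha> / 12)"
    using assms by (intro mult_left_mono) auto
  moreover have "\<alpha> + \<alpha> / 2 * (\<alpha> / 12) \<le> (1 + \<alpha>) * ln (1 + \<alpha>)"
  proof -
    \<comment> \<open>The bound ln y >= 1 - 1/y at y = 1 + \<alpha> would give only \<alpha>.
      Applied at the square root it gains (s - 1)^2, which is at least \<alpha>^2 / 9 as s + 1 < 3,
      and so covers the required \<alpha>^2 / 24.\<close>
    define s where "s = sqrt (1 + \<alpha>)"
    have s: "s\<^sup>2 = 1 + \<alpha>" "s > 1" using assms by (auto simp: s_def)
    have "s < 2" using assms real_sqrt_less_mono[of "1 + \<alpha>" 4] by (simp add: s_def)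
    have "ln (1 / s) \<le> 1 / s - 1" using s by (intro ln_le_minus_one) simp
    then have "1 - 1 / s \<le> ln s" using s by (simp add: ln_div)
    then have "s\<^sup>2 * (2 * (1 - 1 / s)) \<le> s\<^sup>2 * (2 * ln s)" by (intro mult_left_mono) auto
    also have "2 * ln s = ln (1 + \<alpha>)" using s ln_realpow[of s 2] by simp
    also have "s\<^sup>2 * (2 * (1 - 1 / s)) = 2 * s\<^sup>2 - 2 * s"
      using s(2) by (simp add: power2_eq_square field_simps)
    finally have "2 * s\<^sup>2 - 2 * s \<le> (1 + \<alpha>) * ln (1 + \<alpha>)"
      unfolding s(1) .
    moreover have "\<alpha>\<^sup>2 \<le> 9 * (s - 1)\<^sup>2"
    proof -
      have "\<alpha> = (s - 1) * (s + 1)" using s(1) by (simp add: power2_eq_square algebra_simps)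
      also have "\<dots> \<le> (s - 1) * 3" using s(2) \<open>s < 2\<close> by (intro mult_left_mono) auto
      finally have "\<alpha>\<^sup>2 \<le> ((s - 1) * 3)\<^sup>2" using assms by (intro power_mono) auto
      then show ?thesis unfolding power_mult_distrib by simp
    qed
    moreover have "2 * s\<^sup>2 - 2 * s = \<alpha> + (s - 1)\<^sup>2"
      using s(1) by (simp add: power2_eq_square algebra_simps)
    moreover have "\<alpha> / 2 * (\<alpha> / 12) = \<alpha>\<^sup>2 / 24" by (simp add: power2_eq_square)
    ultimately show ?thesis using zero_le_power2[of "s - 1"] by linarith
  qed
  moreover have eq1: "ln (2 * pi * (1 / \<alpha> + 1/12)) = ln (2 * pi) - ln \<alpha> + ln (1 + \<alpha> / 12)"
  proof -
    have "2 * pi * (1 / \<alpha> + 1/12) = 2 * pi / \<alpha> * (1 + \<alpha> / 12)"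
      using assms by (simp add: field_simps)
    then show ?thesis using assms by (simp add: ln_mult_pos ln_div)
  qed
  moreover have eq2: "ln (exp 1 / (2 * pi * \<alpha>)) = 1 - ln (2 * pi) - ln \<alpha>"
    using assms by (simp add: ln_div ln_mult_pos)
  ultimately show ?thesis unfolding eq1 eq2 by (simp add: algebra_simps)
qed

text \<open>\<open>C\<close> is the root above 1 of C (C - 1) = 1 / \<alpha>. Equivalently
  \<open>t\<close> solves \<alpha> t = (1 - t)^2, which says that the derivative of - ln t + t -
  \<alpha> ln (1 - t) vanishes.\<close>

lemma upper_rate:
  fixes \<alpha> :: real
  assumes "0 < \<alpha>"
  defines "C \<equiv> 1/2 + 1/2 * sqrt (1 + 4 / \<alpha>)"
  defines "B \<equiv> \<alpha> * C powr (\<alpha> + 2) * exp (- 1 / C)"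
  defines "t \<equiv> 1 - 1 / C"
  shows "0 < t" "t < 1" "- 1 - ln t + t - \<alpha> * ln (1 - t) = ln B"
proof -
  have "sqrt (1 + 4 / \<alpha>) > 1" using assms by simp
  then have C: "C > 1" unfolding C_def by linarith
  then show "0 < t" "t < 1" by (auto simp: t_def)
  have "C * (C - 1) = ((sqrt (1 + 4 / \<alpha>))\<^sup>2 - 1) / 4"
    by (simp add: C_def power2_eq_square algebra_simps)
  also have "\<dots> = 1 / \<alpha>" using assms by simp
  finally have "\<alpha> = 1 / (C * (C - 1))" using assms C by (simp add: field_simps)
  then have "ln \<alpha> = - ln C - ln (C - 1)" using C by (simp add: ln_div ln_mult_pos)
  moreover have "t = (C - 1) / C" using C by (simp add: t_def field_simps)
  then have "ln t = ln (C - 1) - ln C" using C by (simp add: ln_div)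
  moreover have "ln (1 - t) = - ln C" using C by (simp add: t_def ln_div)
  moreover have "ln B = ln \<alpha> + (\<alpha> + 2) * ln C - 1 / C"
    using C assms(1) by (simp add: B_def ln_mult_pos ln_powr)
  ultimately show "- 1 - ln t + t - \<alpha> * ln (1 - t) = ln B"
    by (simp add: t_def algebra_simps)
qed

section \<open>Passage to the limit\<close>

lemma floor_ratio_tendsto:
  fixes \<alpha> :: real
  assumes "\<alpha> > 0"
  shows "(\<lambda>n. real (nat \<lfloor>\<alpha> * real n\<rfloor>) / real n) \<longlonglongrightarrow> \<alpha>"
proof -
  have "(\<lambda>n. real_of_int \<lfloor>\<alpha> * real n\<rfloor> / real n) \<longlonglongrightarrow> \<alpha>" using assms by real_asymp
  then show ?thesis using assms by simp
qed

lemma liminf_minimax_red: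
  fixes \<alpha> :: real and S :: "nat \<Rightarrow> nat"
  assumes "0 < \<alpha>" "\<alpha> < 1 / 2" and lim: "(\<lambda>n. real (S n) / real n) \<longlonglongrightarrow> \<alpha>"
  shows "liminf (\<lambda>n. minimax_red n (S n)) \<ge> ereal (\<alpha> / 2 * log 2 (exp 1 / (2 * pi * \<alpha>)))"
proof -
  define s where "s n = real (S n) / real n" for n
  \<comment> \<open>The fixed-length bound after Stirling, rewritten in the ratio
    \<open>s n\<close>: the terms of order n ln n cancel, and what remains converges
    termwise.\<close>
  define b where "b n = ((1 + s n) * ln (1 + s n) - s n * ln (s n) - 2 * (ln (real n) / real n)
      - ln (1 + s n) * (1 / real n) - 2 * (1 / real n) - s n / 2 * (ln (2 * pi * (1 / s n + 1/12)) + 1)) / ln 2" for n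
  define L where "L = ((1 + \<alpha>) * ln (1 + \<alpha>) - \<alpha> * ln \<alpha>
     - \<alpha> / 2 * (ln (2 * pi * (1 / \<alpha> + 1/12)) + 1)) / ln 2"
  have s: "s \<longlonglongrightarrow> \<alpha>" using lim by (simp add: s_def [abs_def])
  have "b \<longlonglongrightarrow> ((1 + \<alpha>) * ln (1 + \<alpha>) - \<alpha> * ln \<alpha> - 2 * 0 - ln (1 + \<alpha>) * 0 - 2 * 0
     - \<alpha> / 2 * (ln (2 * pi * (1 / \<alpha> + 1/12)) + 1)) / ln 2"
    unfolding b_def [abs_def]
    using assms add_pos_pos[of "1/\<alpha>" "1/12"]
    by (intro tendsto_intros s lim_ln_over_n lim_1_over_n) auto
  then have "b \<longlonglongrightarrow> L" by (simp add: L_def)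
  then have "liminf (\<lambda>n. ereal (b n)) = ereal L"
    by (intro lim_imp_Liminf) auto
  moreover have "liminf (\<lambda>n. ereal (b n)) \<le> liminf (\<lambda>n. minimax_red n (S n))"
  proof (rule Liminf_mono)
    have "eventually (\<lambda>n. s n > 0) sequentially"
      using order_tendstoD(1)[OF s] assms(1) by simp
    then show "eventually (\<lambda>n. ereal (b n) \<le> minimax_red n (S n)) sequentially"
      using eventually_gt_at_top[of 0]
    proof eventually_elim
      case (elim n)
      then have S: "S n > 0" and n: "n > 0" by (auto simp: s_def zero_less_divide_iff)
      have Sn: "real (S n) = real n * s n" using n by (simp add: s_def)
      have "ln (real (S n)) = ln (real n) + ln (s n)" "ln (real n + real (S n)) = ln (real n) + ln (1 + s n)"
        using n elim ln_mult_pos[of "real n" "1 + s n"] by (auto simp: Sn ln_mult_pos algebra_simps)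
      then have "b n = ((real n + real (S n)) * ln (real n + real (S n)) - real n * ln (real n) - real (S n) * ln (real (S n))
       - ln (real n + real (S n)) - ln (real n) - 2 - real (S n) / 2 * (ln (2 * pi * (real n / real (S n) + 1/12)) + 1)) / (real n * ln 2)"
        using n elim by (simp add: b_def Sn) (simp add: field_simps)
      also have "\<dots> \<le> (ln (pochhammer (real (S n)) n / fact n)
          - real (S n) / 2 * (ln (2 * pi * (real n / real (S n) + 1/12)) + 1)) / (real n * ln 2)"
        using ln_pochhammer_div_fact_lower[OF S n] n by (intro divide_right_mono diff_right_mono) auto
      finally show ?case
        using minimax_red_lower[OF S n] by (meson ereal_less_eq(3) order_trans)
    qed
  qed
  moreover have "\<alpha> / 2 * log 2 (exp 1 / (2 * pi * \<alpha>)) \<le> L"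
    using divide_right_mono[OF lower_rate[OF assms(1,2)], of "ln 2"]
    unfolding L_def log_def times_divide_eq_right by simp
  ultimately show ?thesis by (metis ereal_less_eq(3) order_trans)
qed

lemma limsup_minimax_red:
  fixes \<alpha> :: real and S :: "nat \<Rightarrow> nat"
  assumes "0 < \<alpha>" and lim: "(\<lambda>n. real (S n) / real n) \<longlonglongrightarrow> \<alpha>"
  defines "C \<equiv> 1/2 + 1/2 * sqrt (1 + 4 / \<alpha>)"
  defines "B \<equiv> \<alpha> * C powr (\<alpha> + 2) * exp (- 1 / C)"
  shows "limsup (\<lambda>n. minimax_red n (S n)) \<le> ereal (log 2 B)"
proof -
  define t where "t = 1 - 1 / C"
  have t: "0 < t" "t < 1" "- 1 - ln t + t - \<alpha> * ln (1 - t) = ln B"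
    using upper_rate[OF assms(1)] by (auto simp: t_def B_def C_def)
  define s where "s n = real (S n) / real n" for n
  define b where "b n = (1 / real n + ln (real n) / real n - 1 - ln t + t - s n * ln (1 - t)) / ln 2" for n
  have s: "s \<longlonglongrightarrow> \<alpha>" using lim by (simp add: s_def [abs_def])
  have "b \<longlonglongrightarrow> (0 + 0 - 1 - ln t + t - \<alpha> * ln (1 - t)) / ln 2"
    unfolding b_def [abs_def] by (intro tendsto_intros s lim_ln_over_n lim_1_over_n) auto
  then have "b \<longlonglongrightarrow> log 2 B" using t(3) by (simp add: log_def)
  then have "limsup (\<lambda>n. ereal (b n)) = ereal (log 2 B)"
    by (intro lim_imp_Limsup) auto
  moreover have "limsup (\<lambda>n. minimax_red n (S n)) \<le> limsup (\<lambda>n. ereal (b n))"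
  proof (rule Limsup_mono)
    have "eventually (\<lambda>n. s n > 0) sequentially"
      using order_tendstoD(1)[OF s] assms(1) by simp
    then show "eventually (\<lambda>n. minimax_red n (S n) \<le> ereal (b n)) sequentially"
      using eventually_gt_at_top[of 0]
    proof eventually_elim
      case (elim n)
      then have S: "S n > 0" and n: "n > 0" by (auto simp: s_def zero_less_divide_iff)
      have Sn: "real (S n) = real n * s n" using n by (simp add: s_def)
      have "ln (fact n / real n ^ n) \<le> 1 + ln (real n) - real n"
        using ln_fact_upper[OF n] n by (simp add: ln_div ln_realpow)
      then have "(ln (fact n / real n ^ n) - real n * ln t + real n * t - real (S n) * ln (1 - t)) / (real n * ln 2)
          \<le> (1 + ln (real n) - real n - real n * ln t + real n * t - real (S n) * ln (1 - t)) / (real n * ln 2)"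
        using n by (intro divide_right_mono) auto
      also have "\<dots> = b n"
        using n by (simp add: b_def Sn) (simp add: field_simps)
      finally show ?case
        using minimax_red_upper[OF S n t(1,2)] by (meson ereal_less_eq(3) order_trans)
    qed
  qed
  ultimately show ?thesis by simp
qed

theorem theorem3:
  fixes \<alpha> :: real
  assumes "0 < \<alpha>" and "\<alpha> < exp 1 / (2 * pi)"
  defines "C \<equiv> 1/2 + 1/2 * sqrt (1 + 4 / \<alpha>)"
  defines "B \<equiv> \<alpha> * C powr (\<alpha> + 2) * exp (- 1 / C)"
  shows "liminf (\<lambda>n. minimax_red n (nat \<lfloor>\<alpha> * real n\<rfloor>))
           \<ge> ereal (\<alpha> / 2 * log 2 (exp 1 / (2 * pi * \<alpha>)))
       \<and> limsup (\<lambda>n. minimax_red n (nat \<lfloor>\<alpha> * real n\<rfloor>)) \<le> ereal (log 2 B)"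
proof -
  \<comment> \<open>From e <= 3 < pi.\<close>
  have "exp 1 / (2 * pi) < 1 / 2"
    using exp_le pi_gt3 by (simp add: field_simps)
  with assms(2) have "\<alpha> < 1 / 2" by (rule order.strict_trans)
  then show ?thesis
    unfolding B_def C_def
    by (intro conjI liminf_minimax_red limsup_minimax_red floor_ratio_tendsto assms(1))
qed

end
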